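(* Let $X$ be a reflexive Banach space such that $\Gamma_X'(0) < 1$, where $\Gamma_X'(0) = \lim_{t \to 0^+} \frac{\Gamma_X(t)}{t}$ and $\Gamma_X$ is the modulus of nearly uniform smoothness of $X$. Then $X$ has the fixed point property.
   Context: Let $X$ be a Banach space with closed unit ball $B_X$. The modulus of nearly uniform smoothness of $X$ is the function defined for $t \geq 0$ by $$\Gamma_X(t) = \sup \left\{ \inf_{n > 1} \left( \frac{\| x_1 + t x_n \| + \| x_1 - t x_n \|}{2} - 1 \right) \right\},$$ where the supremum is taken over all basic sequences $(x_n)_{n \geq 1}$ in $B_X$. If $X$ is reflexive (the case relevant here), it is given by $$\Gamma_X(t) = \sup \left\{ \inf_{n>1} \left( \frac{\| x_1 + t x_n \| + \| x_1 - t x_n \|}{2} - 1 \right) : (x_n)_{n\ge 1} \text{ a sequence in } B_X \text{ with } x_n \rightharpoonup 0 \right\},$$ where $\rightharpoonup$ denotes weak convergence; this formula may be taken as the definition for reflexive $X$. Then $\Gamma_X'(0) = \lim_{t \to 0^+} \Gamma_X(t)/t$. A Banach space $X$ has the fixed point property (FPP) if for every nonempty closed bounded convex subset $C \subseteq X$, every nonexpansive mapping $T : C \to C$ (i.e. $\|Tx - Ty\| \leq \|x - y\|$ for all $x, y \in C$) has a fixed point in $C$. *)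

theory Defs
  imports "HOL-Analysis.Analysis"
begin

definition reflexive_space :: "'a::real_normed_vector itself \<Rightarrow> bool" where
  "reflexive_space _ \<longleftrightarrow>
     (\<forall>\<phi> :: ('a \<Rightarrow>\<^sub>L real) \<Rightarrow>\<^sub>L real. \<exists>x::'a. \<forall>f. blinfun_apply \<phi> f = blinfun_apply f x)"

definition weakly_tendsto :: "(nat \<Rightarrow> 'a::real_normed_vector) \<Rightarrow> 'a \<Rightarrow> bool" where
  "weakly_tendsto x l \<longleftrightarrow>
     (\<forall>f :: 'a \<Rightarrow>\<^sub>L real. (\<lambda>n. blinfun_apply f (x n)) \<longlonglongrightarrow> blinfun_apply f l)"

text \<open>
  The modulus of nearly uniform smoothness, in the form valid for reflexive spaces (the general
  definition ranges over basic sequences in the unit ball). Sequences are indexed from 0, so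
  \<open>x 0\<close> is the first term \<open>x\<^sub>1\<close> and the infimum over \<open>n > 1\<close> becomes one over \<open>{1..}\<close>. Both the
  infimum and the supremum are over nonempty families with values in \<open>[-1, t]\<close> when \<open>t \<ge> 0\<close>.
\<close>
definition nus_modulus :: "'a::real_normed_vector itself \<Rightarrow> real \<Rightarrow> real" where
  "nus_modulus _ t =
     (SUP x \<in> {x :: nat \<Rightarrow> 'a. (\<forall>n. x n \<in> cball 0 1) \<and> weakly_tendsto x 0}.
        INF n \<in> {1..}. (norm (x 0 + t *\<^sub>R x n) + norm (x 0 - t *\<^sub>R x n)) / 2 - 1)"

text \<open>
  The limit exists in every nonzero space, see \<open>nus_modulus_quotient_tendsto\<close> below;
  in the zero space the fixed point property is trivial.
\<close>
definition nus_modulus_deriv0 :: "'a::real_normed_vector itself \<Rightarrow> real" where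
  "nus_modulus_deriv0 X = Lim (at_right 0) (\<lambda>t. nus_modulus X t / t)"

definition fixed_point_property :: "'a::real_normed_vector itself \<Rightarrow> bool" where
  "fixed_point_property _ \<longleftrightarrow>
     (\<forall>(C :: 'a set) T. C \<noteq> {} \<and> closed C \<and> bounded C \<and> convex C \<and>
        T ` C \<subseteq> C \<and> 1-lipschitz_on C T \<longrightarrow> (\<exists>x\<in>C. T x = x))"

lemma nus_term_le:
  fixes x y :: "'a::real_normed_vector"
  assumes "norm x \<le> 1" "norm y \<le> 1" "0 \<le> t"
  shows "(norm (x + t *\<^sub>R y) + norm (x - t *\<^sub>R y)) / 2 - 1 \<le> t"
proof -
  have "norm (x + t *\<^sub>R y) \<le> norm x + t * norm y" "norm (x - t *\<^sub>R y) \<le> norm x + t * norm y"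
    using norm_triangle_ineq[of x "t *\<^sub>R y"] norm_triangle_ineq4[of x "t *\<^sub>R y"] assms(3) by auto
  moreover have "t * norm y \<le> t"
    using assms by (simp add: mult_left_le)
  ultimately have "norm (x + t *\<^sub>R y) + norm (x - t *\<^sub>R y) \<le> 2 + 2 * t"
    using assms(1) by argo
  then show ?thesis by (simp add: field_simps)
qed

lemma nus_term_quotient_mono:
  fixes x y :: "'a::real_normed_vector"
  assumes "norm x \<le> 1" "0 < s" "s \<le> t"
  shows "(norm (x + s *\<^sub>R y) + norm (x - s *\<^sub>R y)) / 2 - 1
         \<le> (s / t) * ((norm (x + t *\<^sub>R y) + norm (x - t *\<^sub>R y)) / 2 - 1)"
proof -
  define a where "a = s / t"
  have a: "0 < a" "a \<le> 1" "a * t = s" using assms by (auto simp: a_def)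
  have cvx: "norm (x + (a * u) *\<^sub>R y) \<le> (1 - a) + a * norm (x + u *\<^sub>R y)" for u
  proof -
    have "x + (a * u) *\<^sub>R y = (1 - a) *\<^sub>R x + a *\<^sub>R (x + u *\<^sub>R y)"
      by (simp add: algebra_simps)
    then have "norm (x + (a * u) *\<^sub>R y) \<le> (1 - a) * norm x + a * norm (x + u *\<^sub>R y)"
      using norm_triangle_ineq[of "(1 - a) *\<^sub>R x" "a *\<^sub>R (x + u *\<^sub>R y)"] a by simp
    moreover have "(1 - a) * norm x \<le> 1 - a"
      using a assms(1) by (simp add: mult_left_le)
    ultimately show ?thesis by linarith
  qed
  have "norm (x + s *\<^sub>R y) \<le> (1 - a) + a * norm (x + t *\<^sub>R y)"
    using cvx[of t] a by simp
  moreover have "norm (x - s *\<^sub>R y) \<le> (1 - a) + a * norm (x - t *\<^sub>R y)"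
    using cvx[of "- t"] a by simp
  ultimately have "(norm (x + s *\<^sub>R y) + norm (x - s *\<^sub>R y)) / 2 - 1
      \<le> a * ((norm (x + t *\<^sub>R y) + norm (x - t *\<^sub>R y)) / 2 - 1)"
    by (simp add: field_simps)
  then show ?thesis by (simp add: a_def)
qed

lemma bdd_below_nus_terms:
  "bdd_below ((\<lambda>n::nat. (norm (x 0 + t *\<^sub>R x n) + norm (x 0 - t *\<^sub>R x n)) / 2 - 1) ` A)"
  by (rule bdd_belowI2[where m = "- 1"]) simp

lemma nus_INF_le:
  assumes "\<forall>n. x n \<in> cball 0 1" "0 \<le> t"
  shows "(INF n \<in> {1::nat..}. (norm (x 0 + t *\<^sub>R x n) + norm (x 0 - t *\<^sub>R x n)) / 2 - 1) \<le> t"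
proof -
  have "(INF n \<in> {1::nat..}. (norm (x 0 + t *\<^sub>R x n) + norm (x 0 - t *\<^sub>R x n)) / 2 - 1)
        \<le> (norm (x 0 + t *\<^sub>R x 1) + norm (x 0 - t *\<^sub>R x 1)) / 2 - 1"
    by (rule cINF_lower[OF bdd_below_nus_terms]) simp
  also have "\<dots> \<le> t" using assms by (intro nus_term_le) auto
  finally show ?thesis .
qed

lemma nus_INF_le_modulus:
  fixes x :: "nat \<Rightarrow> 'a::real_normed_vector"
  assumes "\<forall>n. x n \<in> cball 0 1" "weakly_tendsto x 0" "0 \<le> t"
  shows "(INF n \<in> {1..}. (norm (x 0 + t *\<^sub>R x n) + norm (x 0 - t *\<^sub>R x n)) / 2 - 1)
         \<le> nus_modulus TYPE('a) t"
  unfolding nus_modulus_def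
  by (rule cSUP_upper, use assms in simp, rule bdd_aboveI2[where M = t], rule nus_INF_le)
     (use assms in auto)

lemma nus_modulus_quotient_mono:
  assumes "0 < s" "s \<le> t"
  shows "nus_modulus TYPE('a::real_normed_vector) s / s \<le> nus_modulus TYPE('a) t / t"
proof -
  have "nus_modulus TYPE('a) s \<le> (s / t) * nus_modulus TYPE('a) t"
    unfolding nus_modulus_def[of _ s]
  proof (rule cSUP_least)
    show "{x :: nat \<Rightarrow> 'a. (\<forall>n. x n \<in> cball 0 1) \<and> weakly_tendsto x 0} \<noteq> {}"
      by (auto simp: weakly_tendsto_def intro!: exI[of _ "\<lambda>_. 0"])
  next
    fix x :: "nat \<Rightarrow> 'a"
    assume x: "x \<in> {x. (\<forall>n. x n \<in> cball 0 1) \<and> weakly_tendsto x 0}"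
    let ?f = "\<lambda>t n. (norm (x 0 + t *\<^sub>R x n) + norm (x 0 - t *\<^sub>R x n)) / 2 - 1"
    have "(INF n \<in> {1..}. ?f s n) \<le> (s / t) * ?f t n" if "n \<in> {1..}" for n
    proof -
      have "(INF n \<in> {1..}. ?f s n) \<le> ?f s n"
        by (rule cINF_lower[OF bdd_below_nus_terms that])
      also have "\<dots> \<le> (s / t) * ?f t n"
        using x assms by (intro nus_term_quotient_mono) auto
      finally show ?thesis .
    qed
    then have "(t / s) * (INF n \<in> {1..}. ?f s n) \<le> ?f t n" if "n \<in> {1..}" for n
      using that assms by (simp add: field_simps)
    then have "(t / s) * (INF n \<in> {1..}. ?f s n) \<le> (INF n \<in> {1..}. ?f t n)"
      by (intro cINF_greatest) auto
    also have "\<dots> \<le> nus_modulus TYPE('a) t"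
      using x assms by (intro nus_INF_le_modulus) auto
    finally show "(INF n \<in> {1..}. ?f s n) \<le> (s / t) * nus_modulus TYPE('a) t"
      using assms by (simp add: field_simps)
  qed
  then show ?thesis using assms by (simp add: field_simps)
qed

lemma nus_modulus_nonneg:
  assumes "(v::'a::real_normed_vector) \<noteq> 0" "0 \<le> t"
  shows "0 \<le> nus_modulus TYPE('a) t"
proof -
  define x where "x = (\<lambda>n::nat. if n = 0 then sgn v else 0)"
  have "weakly_tendsto x 0"
    unfolding weakly_tendsto_def
  proof
    fix f :: "'a \<Rightarrow>\<^sub>L real"
    have "\<forall>\<^sub>F n in sequentially. f (x n) = f 0"
      by (auto simp: eventually_sequentially x_def intro!: exI[of _ 1])
    then show "(\<lambda>n. f (x n)) \<longlonglongrightarrow> f 0" by (rule tendsto_eventually)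
  qed
  moreover have "\<forall>n. x n \<in> cball 0 1" using assms(1) by (auto simp: x_def norm_sgn)
  ultimately have "(INF n \<in> {1..}. (norm (x 0 + t *\<^sub>R x n) + norm (x 0 - t *\<^sub>R x n)) / 2 - 1)
         \<le> nus_modulus TYPE('a) t"
    using assms(2) by (intro nus_INF_le_modulus)
  moreover have "(INF n \<in> {1..}. (norm (x 0 + t *\<^sub>R x n) + norm (x 0 - t *\<^sub>R x n)) / 2 - 1) \<ge> 0"
    by (rule cINF_greatest) (use assms(1) in \<open>auto simp: x_def norm_sgn\<close>)
  ultimately show ?thesis by linarith
qed

lemma nus_modulus_quotient_tendsto:
  assumes "(v::'a::real_normed_vector) \<noteq> 0"
  shows "((\<lambda>t. nus_modulus TYPE('a) t / t) \<longlongrightarrow> nus_modulus_deriv0 TYPE('a)) (at_right 0)"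
proof -
  let ?q = "\<lambda>t. nus_modulus TYPE('a) t / t"
  let ?L = "INF t \<in> {0<..}. ?q t"
  have bdd: "bdd_below (?q ` {0<..})"
    by (rule bdd_belowI2[where m = 0]) (use nus_modulus_nonneg[OF assms] in simp)
  have "(?q \<longlongrightarrow> ?L) (at_right 0)"
  proof (rule decreasing_tendsto)
    show "\<forall>\<^sub>F t in at_right 0. ?L \<le> ?q t"
      using eventually_at_right_less[of "0::real"]
      by eventually_elim (rule cINF_lower[OF bdd], simp)
  next
    fix y assume "?L < y"
    then obtain s where s: "0 < s" "?q s < y"
      using cINF_less_iff[OF _ bdd] by auto
    have "\<forall>\<^sub>F t in at_right 0. t \<in> {0<..<s}"
      using s(1) by (rule eventually_at_right_real)
    then show "\<forall>\<^sub>F t in at_right 0. ?q t < y"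
      by eventually_elim (use s nus_modulus_quotient_mono[of _ s, where 'a = 'a] in force)
  qed
  then show ?thesis
    unfolding nus_modulus_deriv0_def by (simp add: tendsto_Lim)
qed

end

theory Submission
  imports Defs "HOL-Complex_Analysis.Great_Picard"
begin

text \<open>
  Suppose the fixed point property fails and let \<open>T\<close> be a fixed point free nonexpansive self-map of
  a minimal invariant closed convex set \<open>K\<close> of diameter \<open>d\<close>. Let \<open>x\<^sub>n\<close> be approximate fixed points
  converging weakly to \<open>p\<close>, let \<open>0 < t < 1\<close>, and let \<open>z\<^sub>n\<close> be the fixed point of the contraction
  \<open>z \<mapsto> (1 - c) T z + c (t x\<^sub>n + (1 - t) p)\<close>. For small \<open>c\<close> the points \<open>z\<^sub>n\<close> are almost fixed, so by
  the Goebel-Karlovitz lemma they have distance almost \<open>d\<close> from \<open>p\<close>, whereas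
  \<open>\<parallel>z\<^sub>m - z\<^sub>n\<parallel> \<le> t d\<close> and \<open>\<parallel>z\<^sub>n - x\<^sub>n\<parallel>\<close> is asymptotically at most \<open>(1 - t) d\<close>. Let \<open>z\<^sub>n\<close> converge
  weakly to \<open>q\<close>, and put \<open>y = q - p\<close>, \<open>u\<^sub>n = z\<^sub>n - q\<close>. Then \<open>\<parallel>y\<parallel> \<le> (1 - t) d\<close>, and comparing the
  functionals that norm \<open>y + u\<^sub>n\<close> and \<open>y + u\<^sub>m\<close> shows that both \<open>y \<plusminus> (u\<^sub>m - u\<^sub>n)\<close> have norm almost
  \<open>d\<close> for suitable arbitrarily large \<open>m\<close> and \<open>n\<close>. These differences form a weakly null sequence with
  norms at most \<open>t d\<close>, so the modulus at \<open>t / (1 - t)\<close> is at least \<open>t / (1 - t)\<close>, for every \<open>t\<close>.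
\<close>

section \<open>The Hahn-Banach theorem\<close>

text \<open>The infimum of each fibre is a sublinear functional on the whole space: the first clause
  keeps it below plus infinity, the last one above minus infinity.\<close>

definition bounding_cone :: "('a::real_vector \<times> real) set \<Rightarrow> bool" where
  "bounding_cone S \<longleftrightarrow>
     (\<forall>v. \<exists>r. (v, r) \<in> S) \<and>
     (\<forall>v r w s. (v, r) \<in> S \<longrightarrow> (w, s) \<in> S \<longrightarrow> (v + w, r + s) \<in> S) \<and>
     (\<forall>v r c. (v, r) \<in> S \<longrightarrow> 0 < c \<longrightarrow> (c *\<^sub>R v, c * r) \<in> S) \<and>
     (0, 0) \<in> S \<and> (\<forall>r. (0, r) \<in> S \<longrightarrow> 0 \<le> r)"

lemma bounding_coneD:
  assumes "bounding_cone S"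
  shows "\<exists>r. (v, r) \<in> S"
    and "(v, r) \<in> S \<Longrightarrow> (w, s) \<in> S \<Longrightarrow> (v + w, r + s) \<in> S"
    and "(v, r) \<in> S \<Longrightarrow> 0 < c \<Longrightarrow> (c *\<^sub>R v, c * r) \<in> S"
    and "(0, 0) \<in> S"
    and "(0, r) \<in> S \<Longrightarrow> 0 \<le> r"
  using assms unfolding bounding_cone_def by blast+

text \<open>A point of the cone over \<open>- v\<close> bounds the fibre over \<open>v\<close> from
  below, so the real-valued \<open>Inf\<close> is a genuine infimum.\<close>

lemma bounding_cone_Inf_le:
  assumes S: "bounding_cone S" and "(v, r) \<in> S"
  shows "Inf {r. (v, r) \<in> S} \<le> r"
proof -
  obtain s where s: "(- v, s) \<in> S" using bounding_coneD(1)[OF S] by blast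
  have "bdd_below {r. (v, r) \<in> S}"
  proof (rule bdd_belowI[of _ "- s"])
    fix r assume "r \<in> {r. (v, r) \<in> S}"
    then have "(v + - v, r + s) \<in> S" using bounding_coneD(2)[OF S _ s] by blast
    then show "- s \<le> r" using bounding_coneD(5)[OF S, of "r + s"] by simp
  qed
  then show ?thesis using assms by (auto intro: cInf_lower)
qed

text \<open>
  The Hahn-Banach theorem, with the sublinear functional replaced by its epigraph: extending the
  functional amounts to enlarging the cone, so that Zorn's lemma applies to plain sets.
\<close>
theorem hahn_banach_cone:
  fixes S :: "('a::real_vector \<times> real) set"
  assumes S: "bounding_cone S"
  obtains f where "linear f" "\<And>v r. (v, r) \<in> S \<Longrightarrow> f v \<le> r"
proof -
  let ?A = "{M. bounding_cone M \<and> S \<subseteq> M}"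
  have "\<exists>M\<in>?A. \<forall>X\<in>?A. M \<subseteq> X \<longrightarrow> X = M"
  proof (rule subset_Zorn_nonempty)
    show "?A \<noteq> {}" using S by blast
  next
    fix \<C> assume ne: "\<C> \<noteq> {}" and ch: "subset.chain ?A \<C>"
    have mem: "bounding_cone M" "S \<subseteq> M" if "M \<in> \<C>" for M
      using ch that by (auto simp: subset.chain_def)
    have "(v + w, r + s) \<in> \<Union>\<C>" if vw: "(v, r) \<in> \<Union>\<C>" "(w, s) \<in> \<Union>\<C>" for v w r s
    proof -
      obtain M N where MN: "(v, r) \<in> M" "M \<in> \<C>" "(w, s) \<in> N" "N \<in> \<C>" using vw by blast
      then have "M \<subseteq> N \<or> N \<subseteq> M" using ch by (blast dest: subset.chain_total)
      then obtain L where "L \<in> \<C>" "(v, r) \<in> L" "(w, s) \<in> L" using MN by blast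
      then show ?thesis using bounding_coneD(2)[OF mem(1)] by blast
    qed
    moreover have "\<exists>r. (v, r) \<in> \<Union>\<C>" for v
      using ne mem bounding_coneD(1)[OF S] by blast
    moreover have "(c *\<^sub>R v, c * r) \<in> \<Union>\<C>" if "(v, r) \<in> \<Union>\<C>" "0 < c" for c r v
      using that bounding_coneD(3)[OF mem(1)] by blast
    moreover have "0 \<le> r" if "(0, r) \<in> \<Union>\<C>" for r
      using that bounding_coneD(5)[OF mem(1)] by blast
    moreover have "(0, 0) \<in> \<Union>\<C>"
      using ne bounding_coneD(4)[OF mem(1)] by blast
    ultimately have "bounding_cone (\<Union>\<C>)" unfolding bounding_cone_def by simp
    then show "\<Union>\<C> \<in> ?A" using ne mem(2) by blast
  qed
  then obtain M where "M \<in> ?A" and M_max: "\<forall>X\<in>?A. M \<subseteq> X \<longrightarrow> X = M" by (rule bexE)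
  then have M: "bounding_cone M" "S \<subseteq> M" by simp_all
  have max: "X = M" if "bounding_cone X" "M \<subseteq> X" for X
    using M_max that M(2) by auto
  note MD = bounding_coneD[OF M(1)]
  define f where "f v = Inf {r. (v, r) \<in> M}" for v
  have f_le: "f v \<le> r" if "(v, r) \<in> M" for v r
    unfolding f_def using bounding_cone_Inf_le[OF M(1) that] .
  have f_ge: "b \<le> f v" if "\<And>r. (v, r) \<in> M \<Longrightarrow> b \<le> r" for v b
    unfolding f_def using that MD(1)[of v] by (intro cInf_greatest) auto
  have add: "f (v + w) \<le> f v + f w" for v w
  proof -
    have "f (v + w) - f v \<le> f w"
    proof (rule f_ge)
      fix s assume s: "(w, s) \<in> M"
      have "f (v + w) - s \<le> f v"
      proof (rule f_ge)
        fix r assume "(v, r) \<in> M"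
        then have "f (v + w) \<le> r + s" using f_le MD(2)[OF _ s] by blast
        then show "f (v + w) - s \<le> r" by simp
      qed
      then show "f (v + w) - f v \<le> s" by simp
    qed
    then show ?thesis by simp
  qed
  have scale_le: "f (c *\<^sub>R v) \<le> c * f v" if c: "0 < c" for c v
  proof -
    have "f (c *\<^sub>R v) / c \<le> f v"
    proof (rule f_ge)
      fix r assume "(v, r) \<in> M"
      then have "f (c *\<^sub>R v) \<le> c * r" using f_le MD(3) c by blast
      then show "f (c *\<^sub>R v) / c \<le> r" using c by (simp add: field_simps)
    qed
    then show ?thesis using c by (simp add: field_simps)
  qed
  \<comment> \<open>Linearity comes from maximality: adjoining the ray through
    \<open>(- x, - f x)\<close> to \<open>M\<close> yields a bounding cone \<open>X\<close>, so that
    pair already lies in \<open>M\<close>.\<close>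
  have neg_le: "f (- x) \<le> - f x" for x
  proof -
    define X where "X = {(v - s *\<^sub>R x, r - s * f x) | v r s. (v, r) \<in> M \<and> 0 \<le> s}"
    have "M \<subseteq> X"
    proof clarify
      fix v r assume "(v, r) \<in> M"
      then show "(v, r) \<in> X" unfolding X_def by (force intro: exI[of _ "0::real"])
    qed
    have "bounding_cone X"
      unfolding bounding_cone_def
    proof (intro conjI allI impI)
      fix v show "\<exists>r. (v, r) \<in> X" using MD(1)[of v] \<open>M \<subseteq> X\<close> by blast
    next
      fix v r w s assume "(v, r) \<in> X" "(w, s) \<in> X"
      then obtain v' r' a w' s' b where
        *: "v = v' - a *\<^sub>R x" "r = r' - a * f x" "(v', r') \<in> M" "0 \<le> a"
        "w = w' - b *\<^sub>R x" "s = s' - b * f x" "(w', s') \<in> M" "0 \<le> b"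
        unfolding X_def by auto
      then have "v + w = (v' + w') - (a + b) *\<^sub>R x" "r + s = (r' + s') - (a + b) * f x"
        "(v' + w', r' + s') \<in> M" "0 \<le> a + b"
        using MD(2) by (auto simp: algebra_simps)
      then show "(v + w, r + s) \<in> X" unfolding X_def by blast
    next
      fix v r and c :: real assume "(v, r) \<in> X" "0 < c"
      then obtain v' r' a where
        *: "v = v' - a *\<^sub>R x" "r = r' - a * f x" "(v', r') \<in> M" "0 \<le> a"
        unfolding X_def by auto
      then have "c *\<^sub>R v = c *\<^sub>R v' - (c * a) *\<^sub>R x" "c * r = c * r' - (c * a) * f x"
        "(c *\<^sub>R v', c * r') \<in> M" "0 \<le> c * a"
        using MD(3)[of v' r' c] \<open>0 < c\<close>
        by (simp_all only: scaleR_diff_right scaleR_scaleR right_diff_distrib mult.assoc) simp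
      then show "(c *\<^sub>R v, c * r) \<in> X" unfolding X_def by blast
    next
      show "(0, 0) \<in> X" using \<open>M \<subseteq> X\<close> MD(4) by blast
    next
      fix r assume "(0, r) \<in> X"
      then obtain r' s where s: "r = r' - s * f x" "(s *\<^sub>R x, r') \<in> M" "0 \<le> s"
        unfolding X_def by auto
      show "0 \<le> r"
      proof (cases "s = 0")
        case True then show ?thesis using s MD(5) by auto
      next
        case False
        then have "(x, r' / s) \<in> M" using MD(3)[OF s(2), of "1 / s"] s(3) by simp
        then have "f x \<le> r' / s" by (rule f_le)
        then show ?thesis using s False by (simp add: field_simps)
      qed
    qed
    then have "X = M" using \<open>M \<subseteq> X\<close> max by blast
    moreover have "(- x, - f x) \<in> X"
    proof -
      have "- x = 0 - 1 *\<^sub>R x" "- f x = 0 - 1 * f x" by simp_all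
      then show ?thesis unfolding X_def using MD(4) zero_le_one by blast
    qed
    ultimately show ?thesis using f_le by blast
  qed
  have f0: "f 0 = 0" using f_le[OF MD(4)] f_ge[of 0 0] MD(5) by force
  have neg: "f (- x) = - f x" for x
    using neg_le[of x] add[of x "- x"] f0 by simp
  have "linear f"
  proof (rule linearI)
    fix v w
    have "f (- v + - w) \<le> f (- v) + f (- w)" by (rule add)
    moreover have "f (- v + - w) = - f (v + w)" using neg[of "v + w"] by simp
    ultimately show "f (v + w) = f v + f w" using add[of v w] neg by simp
  next
    fix c :: real and v
    have pos: "f (c *\<^sub>R v) = c * f v" if "0 < c" for c v
      using scale_le[OF that, of v] scale_le[OF that, of "- v"] neg[of v] neg[of "c *\<^sub>R v"] by simp
    consider "c = 0" | "0 < c" | "0 < - c" by linarith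
    then show "f (c *\<^sub>R v) = c *\<^sub>R f v"
    proof cases
      case 3
      then show ?thesis using pos[of "- c" v] neg[of "c *\<^sub>R v"] by simp
    qed (auto simp: f0 pos)
  qed
  then show ?thesis using f_le M(2) by (intro that) auto
qed

text \<open>
  Here \<open>S\<close> is essentially the epigraph of the largest sublinear functional that is dominated by the
  norm and is at most \<open>- r\<close> on \<open>C - z\<close>.
\<close>
lemma convex_separation:
  fixes C :: "'a::real_normed_vector set"
  assumes "convex C" "C \<noteq> {}" "0 \<le> r" and dist: "\<And>c. c \<in> C \<Longrightarrow> r \<le> norm (c - z)"
  obtains f :: "'a \<Rightarrow>\<^sub>L real" where "norm f \<le> 1" "\<And>c. c \<in> C \<Longrightarrow> f c \<le> f z - r"
proof -
  define S where "S = {(v, x). \<exists>l\<ge>0. \<exists>c\<in>C. norm (v - l *\<^sub>R (c - z)) - l * r \<le> x}"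
  have S_I: "(v, x) \<in> S" if "c \<in> C" "0 \<le> l" "norm (v - l *\<^sub>R (c - z)) - l * r \<le> x" for v x l c
    using that unfolding S_def by blast
  obtain c0 where c0: "c0 \<in> C" using assms(2) by blast
  have "bounding_cone S"
    unfolding bounding_cone_def
  proof (intro conjI allI impI)
    fix v show "\<exists>x. (v, x) \<in> S" using S_I[OF c0, of 0 v "norm v"] by auto
  next
    fix v x w y assume "(v, x) \<in> S" "(w, y) \<in> S"
    then obtain l c m d where
      *: "norm (v - l *\<^sub>R (c - z)) - l * r \<le> x" "norm (w - m *\<^sub>R (d - z)) - m * r \<le> y"
      "0 \<le> l" "0 \<le> m" "c \<in> C" "d \<in> C"
      unfolding S_def by auto
    obtain e where e: "e \<in> C" "(l + m) *\<^sub>R (e - z) = l *\<^sub>R (c - z) + m *\<^sub>R (d - z)"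
    proof (cases "l + m = 0")
      case True
      then have "l = 0" "m = 0" using *(3,4) by auto
      then show ?thesis using that[of c] *(5) by simp
    next
      case False
      define e where "e = (l / (l + m)) *\<^sub>R c + (m / (l + m)) *\<^sub>R d"
      have "e \<in> C"
        unfolding e_def using assms(1) * False
        by (intro convexD) (auto simp: add_divide_distrib[symmetric])
      moreover have "(l + m) *\<^sub>R e = l *\<^sub>R c + m *\<^sub>R d"
        using False by (simp add: e_def scaleR_add_right)
      ultimately show ?thesis using that[of e] by (simp add: algebra_simps)
    qed
    have "norm ((v + w) - (l + m) *\<^sub>R (e - z))
        = norm ((v - l *\<^sub>R (c - z)) + (w - m *\<^sub>R (d - z)))"
      unfolding e(2) by (simp add: algebra_simps)
    also have "\<dots> \<le> norm (v - l *\<^sub>R (c - z)) + norm (w - m *\<^sub>R (d - z))"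
      by (rule norm_triangle_ineq)
    finally show "(v + w, x + y) \<in> S"
      using * e(1) by (intro S_I[of e "l + m"]) (auto simp: algebra_simps)
  next
    fix v x and a :: real assume "(v, x) \<in> S" "0 < a"
    then obtain l c where
      *: "norm (v - l *\<^sub>R (c - z)) - l * r \<le> x" "0 \<le> l" "c \<in> C"
      unfolding S_def by auto
    have "norm (a *\<^sub>R v - (a * l) *\<^sub>R (c - z)) = norm (a *\<^sub>R (v - l *\<^sub>R (c - z)))"
      by (simp add: algebra_simps)
    also have "\<dots> = a * norm (v - l *\<^sub>R (c - z))" using \<open>0 < a\<close> by simp
    also have "\<dots> - a * l * r \<le> a * x"
      using mult_left_mono[OF *(1), of a] \<open>0 < a\<close> by (simp add: algebra_simps)
    finally show "(a *\<^sub>R v, a * x) \<in> S"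
      using * \<open>0 < a\<close> by (intro S_I[of c "a * l"]) auto
  next
    show "(0, 0) \<in> S" using S_I[OF c0, of 0] by auto
  next
    fix x assume "(0, x) \<in> S"
    then obtain l c where "norm (- (l *\<^sub>R (c - z))) - l * r \<le> x" "0 \<le> l" "c \<in> C"
      unfolding S_def by auto
    then show "0 \<le> x" using mult_left_mono[OF dist[of c], of l] by simp
  qed
  then obtain f where f: "linear f" "\<And>v x. (v, x) \<in> S \<Longrightarrow> f v \<le> x"
    by (rule hahn_banach_cone) blast
  \<comment> \<open>The choice \<open>l = 0\<close> in \<open>S\<close> yields domination by the
    norm; \<open>l = 1\<close> will yield the gap \<open>r\<close>.\<close>
  have "f v \<le> norm v" for v using f(2)[OF S_I[OF c0, of 0 v "norm v"]] by simp
  then have "norm (f v) \<le> norm v" for v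
    using linear_neg[OF f(1), of v] by (smt (verit) norm_minus_cancel real_norm_def)
  then have bl: "bounded_linear f" using f(1)
    by (intro bounded_linear_intro[where K = 1]) (auto simp: linear_add linear_scale)
  show ?thesis
  proof (rule that[of "Blinfun f"])
    show "norm (Blinfun f) \<le> 1"
      using bl \<open>\<And>v. norm (f v) \<le> norm v\<close>
      by (intro norm_blinfun_bound) (auto simp: bounded_linear_Blinfun_apply)
  next
    fix c assume "c \<in> C"
    then have "f (c - z) \<le> - r" using f(2)[OF S_I[of c 1 "c - z" "- r"]] by simp
    then show "Blinfun f c \<le> Blinfun f z - r"
      using bl f(1) by (simp add: bounded_linear_Blinfun_apply linear_diff)
  qed
qed

lemma blinfun_le_norm:
  fixes f :: "'a::real_normed_vector \<Rightarrow>\<^sub>L real"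
  assumes "norm f \<le> 1"
  shows "f v \<le> norm v"
  using norm_blinfun[of f v] mult_right_mono[OF assms, of "norm v"] by simp

text \<open>Separating \<open>z\<close> from the singleton \<open>{0}\<close>, which lies at
  distance \<open>norm z\<close>, forces \<open>f z\<close> to be at least
  \<open>norm z\<close>.\<close>

lemma norming_functional:
  fixes z :: "'a::real_normed_vector"
  obtains f :: "'a \<Rightarrow>\<^sub>L real" where "norm f \<le> 1" "f z = norm z"
proof -
  obtain f :: "'a \<Rightarrow>\<^sub>L real" where f: "norm f \<le> 1" "\<And>c. c \<in> {0} \<Longrightarrow> f c \<le> f z - norm z"
    by (rule convex_separation[of "{0}" "norm z" z]) auto
  moreover have "f z \<le> norm z"
    by (rule blinfun_le_norm[OF f(1)])
  ultimately show ?thesis using that[of f] by (simp add: blinfun.zero_right)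
qed

text \<open>Otherwise separation with gap \<open>infdist z C\<close> bounds some functional on
  \<open>C\<close> by less than its value at \<open>z\<close>.\<close>

lemma mem_closed_convexI:
  fixes C :: "'a::real_normed_vector set"
  assumes "closed C" "convex C" "C \<noteq> {}"
    and le: "\<And>(f :: 'a \<Rightarrow>\<^sub>L real) r. (\<And>c. c \<in> C \<Longrightarrow> f c \<le> r) \<Longrightarrow> f z \<le> r"
  shows "z \<in> C"
proof (rule ccontr)
  assume "z \<notin> C"
  then have pos: "0 < infdist z C"
    using assms by (simp add: in_closed_iff_infdist_zero infdist_pos_not_in_closed)
  obtain f :: "'a \<Rightarrow>\<^sub>L real" where "\<And>c. c \<in> C \<Longrightarrow> f c \<le> f z - infdist z C"
    using convex_separation[OF assms(2,3) infdist_nonneg, of z C z]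
    by (metis dist_commute dist_norm infdist_le)
  then have "f z \<le> f z - infdist z C" by (rule le)
  then show False using pos by simp
qed

section \<open>Weak convergence in reflexive spaces\<close>

lemma weakly_tendstoD:
  fixes f :: "'a::real_normed_vector \<Rightarrow>\<^sub>L real"
  shows "weakly_tendsto x l \<Longrightarrow> (\<lambda>n. f (x n)) \<longlonglongrightarrow> f l"
  by (simp add: weakly_tendsto_def)

lemma weakly_tendsto_const: "weakly_tendsto (\<lambda>_. a) a"
  by (simp add: weakly_tendsto_def)

lemma weakly_tendsto_diff:
  "weakly_tendsto x l \<Longrightarrow> weakly_tendsto y m \<Longrightarrow> weakly_tendsto (\<lambda>n. x n - y n) (l - m)"
  by (auto simp: weakly_tendsto_def blinfun.diff_right intro!: tendsto_diff)

lemma weakly_tendsto_scaleR: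
  "weakly_tendsto x l \<Longrightarrow> weakly_tendsto (\<lambda>n. c *\<^sub>R x n) (c *\<^sub>R l)"
  by (auto simp: weakly_tendsto_def blinfun.scaleR_right intro!: tendsto_mult)

lemma weakly_tendsto_compose:
  "weakly_tendsto x l \<Longrightarrow> filterlim s sequentially sequentially \<Longrightarrow> weakly_tendsto (\<lambda>n. x (s n)) l"
  unfolding weakly_tendsto_def using filterlim_compose by blast

lemma weakly_tendsto_cong_sequentially:
  assumes "weakly_tendsto x l" "\<forall>\<^sub>F n in sequentially. x n = y n"
  shows "weakly_tendsto y l"
  unfolding weakly_tendsto_def
proof
  fix f :: "'a \<Rightarrow>\<^sub>L real"
  have "\<forall>\<^sub>F n in sequentially. f (x n) = f (y n)" using assms(2) by eventually_elim simp
  then show "(\<lambda>n. f (y n)) \<longlonglongrightarrow> f l"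
    using weakly_tendstoD[OF assms(1)] by (rule Lim_transform_eventually[rotated])
qed

text \<open>A half-space bound valid on \<open>C\<close> survives weak limits, and such bounds
  determine a closed convex set.\<close>

lemma weakly_tendsto_mem_closed_convex:
  assumes "closed C" "convex C" "weakly_tendsto x l" "\<forall>\<^sub>F n in sequentially. x n \<in> C"
  shows "l \<in> C"
proof (rule mem_closed_convexI)
  show "C \<noteq> {}" using assms(4) eventually_happens by fastforce
next
  fix f :: "'a \<Rightarrow>\<^sub>L real" and r assume "\<And>c. c \<in> C \<Longrightarrow> f c \<le> r"
  then have "\<forall>\<^sub>F n in sequentially. f (x n) \<le> r" using assms(4) by (auto elim: eventually_mono)
  then show "f l \<le> r" using weakly_tendstoD[OF assms(3)] by (intro tendsto_upperbound) auto
qed (fact assms)+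

lemma weakly_tendsto_norm_le:
  assumes "weakly_tendsto x l" "\<forall>\<^sub>F n in sequentially. norm (x n) \<le> r"
  shows "norm l \<le> r"
  using weakly_tendsto_mem_closed_convex[of "cball 0 r" x l] assms by simp

section \<open>Compactness properties of reflexive spaces\<close>

text \<open>A form of weak compactness: the bounds that functionals satisfy on some member of the
  family form a cone over the dual, Hahn-Banach turns this cone into an element of the bidual, and
  reflexivity represents that element by a point.\<close>

lemma reflexive_directed_point:
  fixes \<C> :: "'a::real_normed_vector set set"
  assumes "reflexive_space TYPE('a)" "\<C> \<noteq> {}"
    and "\<And>C. C \<in> \<C> \<Longrightarrow> C \<noteq> {}" "\<And>C. C \<in> \<C> \<Longrightarrow> bounded C"
    and directed: "\<And>C D. C \<in> \<C> \<Longrightarrow> D \<in> \<C> \<Longrightarrow> \<exists>E\<in>\<C>. E \<subseteq> C \<inter> D"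
  shows "\<exists>z. \<forall>C\<in>\<C>. \<forall>(f :: 'a \<Rightarrow>\<^sub>L real) r. (\<forall>x\<in>C. f x \<le> r) \<longrightarrow> f z \<le> r"
proof -
  define S where "S = {(f :: 'a \<Rightarrow>\<^sub>L real, r). \<exists>C\<in>\<C>. \<forall>x\<in>C. f x \<le> r}"
  obtain C0 where C0: "C0 \<in> \<C>" using assms(2) by blast
  obtain M where M: "0 < M" "\<And>x. x \<in> C0 \<Longrightarrow> norm x \<le> M"
    using assms(4)[OF C0] by (auto simp: bounded_pos)
  \<comment> \<open>This serves twice: every fibre of \<open>S\<close> is nonempty, and the
    functional obtained from \<open>S\<close> is bounded.\<close>
  have S_norm: "(f, M * norm f) \<in> S" for f
  proof -
    have "f x \<le> M * norm f" if "x \<in> C0" for x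
      using norm_blinfun[of f x] mult_right_mono[OF M(2)[OF that], of "norm f"]
      by (simp add: mult.commute)
    then show ?thesis using C0 unfolding S_def by blast
  qed
  have "bounding_cone S"
    unfolding bounding_cone_def
  proof (intro conjI allI impI)
    fix f show "\<exists>r. (f, r) \<in> S" using S_norm by blast
  next
    fix f r g s assume "(f, r) \<in> S" "(g, s) \<in> S"
    then obtain C D where CD: "C \<in> \<C>" "\<And>x. x \<in> C \<Longrightarrow> f x \<le> r" "D \<in> \<C>" "\<And>x. x \<in> D \<Longrightarrow> g x \<le> s"
      unfolding S_def by auto
    obtain E where "E \<in> \<C>" "E \<subseteq> C \<inter> D" using directed CD by blast
    moreover have "(f + g) x \<le> r + s" if "x \<in> E" for x
      using CD(2)[of x] CD(4)[of x] that \<open>E \<subseteq> C \<inter> D\<close> by (auto simp: blinfun.add_left intro: add_mono)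
    ultimately show "(f + g, r + s) \<in> S" unfolding S_def by blast
  next
    fix f r and c :: real assume "(f, r) \<in> S" "0 < c"
    then show "(c *\<^sub>R f, c * r) \<in> S"
      unfolding S_def by (fastforce simp: blinfun.scaleR_left)
  next
    show "(0, 0) \<in> S" using S_norm[of 0] by simp
  next
    fix r assume "(0, r) \<in> S"
    then show "0 \<le> r" using assms(3) unfolding S_def by fastforce
  qed
  then obtain \<phi> where \<phi>: "linear \<phi>" "\<And>f r. (f, r) \<in> S \<Longrightarrow> \<phi> f \<le> r"
    by (rule hahn_banach_cone) blast
  have "norm (\<phi> f) \<le> M * norm f" for f
    using \<phi>(2)[OF S_norm[of f]] \<phi>(2)[OF S_norm[of "- f"]] linear_neg[OF \<phi>(1), of f]
    by (simp add: abs_le_iff)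
  then have bl: "bounded_linear \<phi>" using \<phi>(1)
    by (intro bounded_linear_intro[where K = M]) (auto simp: linear_add linear_scale mult.commute)
  obtain z where z: "\<And>f. Blinfun \<phi> f = blinfun_apply f z"
    using assms(1) unfolding reflexive_space_def by blast
  show ?thesis
  proof (intro exI ballI allI impI)
    fix C and f :: "'a \<Rightarrow>\<^sub>L real" and r
    assume "C \<in> \<C>" "\<forall>x\<in>C. f x \<le> r"
    then have "(f, r) \<in> S" unfolding S_def by blast
    then have "\<phi> f \<le> r" by (rule \<phi>(2))
    then show "f z \<le> r" using z[of f] bl by (simp add: bounded_linear_Blinfun_apply)
  qed
qed

text \<open>The point given by the directed family obeys every half-space bound of each member,
  hence lies in it. For chains this supplies the lower bounds in Zorn's lemma.\<close>

lemma reflexive_Inter_nonempty: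
  fixes \<C> :: "'a::real_normed_vector set set"
  assumes "reflexive_space TYPE('a)" "\<C> \<noteq> {}"
    and "\<And>C. C \<in> \<C> \<Longrightarrow> C \<noteq> {} \<and> bounded C \<and> closed C \<and> convex C"
    and "\<And>C D. C \<in> \<C> \<Longrightarrow> D \<in> \<C> \<Longrightarrow> \<exists>E\<in>\<C>. E \<subseteq> C \<inter> D"
  shows "\<Inter>\<C> \<noteq> {}"
proof -
  have "\<exists>z. \<forall>C\<in>\<C>. \<forall>(f :: 'a \<Rightarrow>\<^sub>L real) r. (\<forall>x\<in>C. f x \<le> r) \<longrightarrow> f z \<le> r"
    using assms(3) by (intro reflexive_directed_point[OF assms(1,2) _ _ assms(4)]) simp_all
  then obtain z where
    z: "\<forall>C\<in>\<C>. \<forall>(f :: 'a \<Rightarrow>\<^sub>L real) r. (\<forall>x\<in>C. f x \<le> r) \<longrightarrow> f z \<le> r" ..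
  have "z \<in> C" if "C \<in> \<C>" for C
    using assms(3)[OF that] z that by (intro mem_closed_convexI[of C]) simp_all
  then show ?thesis by blast
qed

text \<open>The tails form a directed family. The first property places \<open>z\<close> in closed
  convex sets containing the sequence; the second determines \<open>z\<close> on functionals that
  converge along it.\<close>

lemma reflexive_cluster_point:
  fixes x :: "nat \<Rightarrow> 'a::real_normed_vector"
  assumes "reflexive_space TYPE('a)" "bounded (range x)"
  obtains z where
    "\<And>(f :: 'a \<Rightarrow>\<^sub>L real) r. (\<And>n. f (x n) \<le> r) \<Longrightarrow> f z \<le> r"
    "\<And>(f :: 'a \<Rightarrow>\<^sub>L real) r. (\<lambda>n. f (x n)) \<longlonglongrightarrow> r \<Longrightarrow> f z = r"
proof -
  let ?\<C> = "range (\<lambda>n. x ` {n..})"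
  have "\<exists>E\<in>?\<C>. E \<subseteq> C \<inter> D" if CD: "C \<in> ?\<C>" "D \<in> ?\<C>" for C D
  proof -
    obtain m n where "C = x ` {m..}" "D = x ` {n..}" using CD by blast
    then have "x ` {max m n..} \<subseteq> C \<inter> D" by auto
    then show ?thesis by blast
  qed
  moreover have "bounded C" "C \<noteq> {}" if "C \<in> ?\<C>" for C
    using that by (auto intro: bounded_subset[OF assms(2)])
  ultimately have "\<exists>z. \<forall>C\<in>?\<C>. \<forall>(f :: 'a \<Rightarrow>\<^sub>L real) r. (\<forall>x\<in>C. f x \<le> r) \<longrightarrow> f z \<le> r"
    by (intro reflexive_directed_point[OF assms(1)]) simp_all
  then obtain z where
    z: "\<forall>C\<in>?\<C>. \<forall>(f :: 'a \<Rightarrow>\<^sub>L real) r. (\<forall>x\<in>C. f x \<le> r) \<longrightarrow> f z \<le> r" ..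
  have le: "f z \<le> r" if "\<forall>\<^sub>F n in sequentially. f (x n) \<le> r" for f :: "'a \<Rightarrow>\<^sub>L real" and r
    using that z by (auto simp: eventually_sequentially)
  have le_lim: "f z \<le> r" if "(\<lambda>n. f (x n)) \<longlonglongrightarrow> r" for f :: "'a \<Rightarrow>\<^sub>L real" and r
  proof (rule field_le_epsilon)
    fix e :: real assume "0 < e"
    then have "\<forall>\<^sub>F n in sequentially. f (x n) < r + e"
      using that by (intro order_tendstoD(2)) auto
    then show "f z \<le> r + e" by (intro le) (auto elim: eventually_mono)
  qed
  show ?thesis
  proof (rule that[of z])
    fix f :: "'a \<Rightarrow>\<^sub>L real" and r assume lim: "(\<lambda>n. f (x n)) \<longlonglongrightarrow> r"
    then have "(\<lambda>n. (- f) (x n)) \<longlonglongrightarrow> - r"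
      by (auto simp: blinfun.minus_left intro: tendsto_minus)
    then show "f z = r" using le_lim[of "- f" "- r"] le_lim[OF lim] by (simp add: blinfun.minus_left)
  qed (use le in simp)
qed

lemma countable_dense_in_subspace:
  fixes x :: "nat \<Rightarrow> 'a::real_normed_vector"
  obtains Q where "countable Q" "range x \<subseteq> Q" "subspace (closure Q)"
proof -
  \<comment> \<open>Finite rational combinations are coded as lists of coefficient-index pairs: such
    lists are countable, and appending them adds the combinations.\<close>
  define comb where "comb l = (\<Sum>(q, i)\<leftarrow>l. real_of_rat q *\<^sub>R x i)" for l
  let ?Q = "range comb"
  have Q_add: "v + w \<in> ?Q" if vw: "v \<in> ?Q" "w \<in> ?Q" for v w
  proof -
    obtain l m where "v = comb l" "w = comb m" using vw by blast
    then have "v + w = comb (l @ m)" by (simp add: comb_def)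
    then show ?thesis by simp
  qed
  have Q_scale: "real_of_rat p *\<^sub>R v \<in> ?Q" if v: "v \<in> ?Q" for v p
  proof -
    obtain l where v: "v = comb l" using v by blast
    have "real_of_rat p *\<^sub>R comb l = comb (map (\<lambda>(q, i). (p * q, i)) l)"
      by (induction l) (auto simp: comb_def scaleR_add_right of_rat_mult)
    then show ?thesis using v by simp
  qed
  have "x i \<in> ?Q" for i
    by (rule range_eqI[of _ _ "[(1, i)]"]) (simp add: comb_def)
  moreover have "subspace (closure ?Q)"
    unfolding subspace_def
  proof (intro conjI ballI allI)
    have "comb [] = 0" by (simp add: comb_def)
    then show "0 \<in> closure ?Q" by (metis closure_subset range_eqI subsetD)
  next
    fix v w assume "v \<in> closure ?Q" "w \<in> closure ?Q"
    then obtain a b where ab: "\<And>n. a n \<in> ?Q" "a \<longlonglongrightarrow> v" "\<And>n. b n \<in> ?Q" "b \<longlonglongrightarrow> w"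
      unfolding closure_sequential by metis
    have "a n + b n \<in> ?Q" for n using ab(1,3) by (rule Q_add)
    then show "v + w \<in> closure ?Q"
      unfolding closure_sequential using tendsto_add[OF ab(2,4)]
      by (intro exI[of _ "\<lambda>n. a n + b n"]) simp
  next
    fix c :: real and v assume "v \<in> closure ?Q"
    then obtain a where a: "\<And>n. a n \<in> ?Q" "a \<longlonglongrightarrow> v"
      unfolding closure_sequential by metis
    have "\<exists>q\<in>\<rat>. dist q c < e" if "0 < e" for e
      using Rats_dense_in_real[of c "c + e"] that by (force simp: dist_real_def)
    then have "c \<in> closure \<rat>" by (simp add: closure_approachable)
    then obtain q where q: "\<And>n. q n \<in> \<rat>" "q \<longlonglongrightarrow> c"
      unfolding closure_sequential by metis
    have "q n *\<^sub>R a n \<in> ?Q" for n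
      using q(1)[of n] Q_scale[OF a(1)[of n]] by (metis Rats_cases)
    then show "c *\<^sub>R v \<in> closure ?Q"
      unfolding closure_sequential using tendsto_scaleR[OF q(2) a(2)]
      by (intro exI[of _ "\<lambda>n. q n *\<^sub>R a n"]) simp
  qed
  ultimately show ?thesis by (intro that[of ?Q]) auto
qed

text \<open>
  Countably many functionals, norming a countable dense subset of the closed span, separate its
  points. A diagonal subsequence along which all of them converge has only one weak cluster point.
\<close>
theorem reflexive_weakly_convergent_subseq:
  fixes x :: "nat \<Rightarrow> 'a::real_normed_vector"
  assumes refl: "reflexive_space TYPE('a)" and bdd: "bounded (range x)"
  obtains s l where "strict_mono s" "weakly_tendsto (\<lambda>n. x (s n)) l"
proof -
  obtain Q where Q: "countable Q" "range x \<subseteq> Q" "subspace (closure Q)"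
    by (rule countable_dense_in_subspace)
  have "\<forall>y. \<exists>f :: 'a \<Rightarrow>\<^sub>L real. norm f \<le> 1 \<and> blinfun_apply f y = norm y"
    using norming_functional by metis
  then obtain F :: "'a \<Rightarrow> ('a \<Rightarrow>\<^sub>L real)" where F: "\<And>y. norm (F y) \<le> 1" "\<And>y. F y y = norm y"
    by metis
  obtain M where M: "\<And>n. norm (x n) \<le> M" using bdd by (auto simp: bounded_iff)
  have "norm (F y (x n)) \<le> M" for n y
    using blinfun_le_norm[OF F(1), of y "x n"] blinfun_le_norm[OF F(1), of y "- x n"] M[of n]
    by (simp add: blinfun.minus_right abs_le_iff)
  \<comment> \<open>Diagonal argument: for \<open>y\<close> in the countable set \<open>Q\<close>
    the values \<open>F y (x n)\<close> are bounded by \<open>M\<close>, so one subsequence serves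
    all \<open>y\<close>.\<close>
  then obtain k where k: "strict_mono k" "\<And>y. y \<in> Q \<Longrightarrow> \<exists>l. (\<lambda>n. F y (x (k n))) \<longlonglongrightarrow> l"
    by (rule function_convergent_subsequence[OF Q(1), of "\<lambda>n y. F y (x n)" M]) blast
  \<comment> \<open>If \<open>y\<close> is close to \<open>z\<close> and \<open>F y\<close> kills
    \<open>z\<close>, then \<open>norm y = F y (y - z)\<close> is small, and so is
    \<open>norm z\<close>.\<close>
  have separates: "z = 0" if z: "z \<in> closure Q" and "\<And>y. y \<in> Q \<Longrightarrow> F y z = 0" for z
  proof -
    have "norm z \<le> 0"
    proof (rule field_le_epsilon)
      fix e :: real assume "0 < e"
      then obtain y where y: "y \<in> Q" "dist y z < e / 2"
        using z by (meson closure_approachable half_gt_zero)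
      have "norm y = F y (y - z)" using that(2)[OF y(1)] F(2) by (simp add: blinfun.diff_right)
      also have "\<dots> \<le> dist y z" using blinfun_le_norm[OF F(1)] by (simp add: dist_norm)
      finally show "norm z \<le> 0 + e"
        using y(2) norm_triangle_ineq3[of z y] by (simp add: dist_norm norm_minus_commute)
    qed
    then show ?thesis by simp
  qed
  have cluster: "\<exists>z\<in>closure Q. \<forall>(f :: 'a \<Rightarrow>\<^sub>L real) r. (\<lambda>n. f (x (k (j n)))) \<longlonglongrightarrow> r \<longrightarrow> f z = r" for j
  proof -
    have "bounded (range (\<lambda>n. x (k (j n))))" using M by (auto simp: bounded_iff)
    then obtain z where
      z: "\<And>(f :: 'a \<Rightarrow>\<^sub>L real) r. (\<And>n. f (x (k (j n))) \<le> r) \<Longrightarrow> f z \<le> r"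
      "\<And>(f :: 'a \<Rightarrow>\<^sub>L real) r. (\<lambda>n. f (x (k (j n)))) \<longlonglongrightarrow> r \<Longrightarrow> f z = r"
      by (rule reflexive_cluster_point[OF refl]) blast
    have xQ: "x n \<in> closure Q" for n using Q(2) closure_subset by blast
    then have "z \<in> closure Q"
      using Q(3) z(1) by (intro mem_closed_convexI) (auto simp: subspace_imp_convex)
    then show ?thesis using z(2) by blast
  qed
  obtain z where z: "z \<in> closure Q"
    "\<And>(f :: 'a \<Rightarrow>\<^sub>L real) r. (\<lambda>n. f (x (k n))) \<longlonglongrightarrow> r \<Longrightarrow> f z = r"
    using cluster[of "\<lambda>n. n"] by blast
  have "weakly_tendsto (\<lambda>n. x (k n)) z"
    unfolding weakly_tendsto_def
  \<comment> \<open>If \<open>g\<close> failed to converge to \<open>g z\<close>, some subsequence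
    would keep its values at distance \<open>e\<close> from \<open>g z\<close> while they converge
    to \<open>L\<close>. A cluster point \<open>w\<close> of it agrees with \<open>z\<close> under
    every \<open>F y\<close>, so \<open>w = z\<close> and \<open>L = g z\<close>.\<close>
  proof (rule allI, rule ccontr)
    fix g :: "'a \<Rightarrow>\<^sub>L real"
    assume "\<not> (\<lambda>n. g (x (k n))) \<longlonglongrightarrow> g z"
    then obtain e where e: "0 < e" "\<exists>\<^sub>F n in sequentially. e \<le> dist (g (x (k n))) (g z)"
      by (auto simp: tendsto_iff frequently_def not_le)
    then have "infinite {n. e \<le> dist (g (x (k n))) (g z)}"
      by (simp add: frequently_cofinite flip: cofinite_eq_sequentially)
    from infinite_enumerate[OF this]
    obtain j :: "nat \<Rightarrow> nat" where "strict_mono j" "\<forall>n. j n \<in> {n. e \<le> dist (g (x (k n))) (g z)}"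
      by blast
    then have j: "strict_mono j" "\<And>n. e \<le> dist (g (x (k (j n)))) (g z)" by simp_all
    have "bounded (range (\<lambda>n. g (x (k (j n)))))"
      using bounded_linear_image[OF bdd blinfun.bounded_linear_right, of g]
      by (rule bounded_subset) auto
    then obtain L i where i: "strict_mono i" "(\<lambda>n. g (x (k (j (i n))))) \<longlonglongrightarrow> L"
      using bounded_imp_convergent_subsequence unfolding comp_def by blast
    obtain w where w: "w \<in> closure Q"
      "\<And>(f :: 'a \<Rightarrow>\<^sub>L real) r. (\<lambda>n. f (x (k (j (i n))))) \<longlonglongrightarrow> r \<Longrightarrow> f w = r"
      using cluster[of "\<lambda>n. j (i n)"] by blast
    have "z - w = 0"
    proof (rule separates)
      show "z - w \<in> closure Q" using Q(3) z(1) w(1) by (rule subspace_diff)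
      fix y assume "y \<in> Q"
      then obtain l where l: "(\<lambda>n. F y (x (k n))) \<longlonglongrightarrow> l" using k(2) by blast
      have "strict_mono (\<lambda>n. j (i n))" using j(1) i(1) by (simp add: strict_mono_def)
      then have "(\<lambda>n. F y (x (k (j (i n))))) \<longlonglongrightarrow> l"
        using LIMSEQ_subseq_LIMSEQ[OF l] by (simp add: comp_def)
      then show "F y (z - w) = 0" using w(2) z(2)[OF l] by (simp add: blinfun.diff_right)
    qed
    then have "g z = L" using w(2)[OF i(2)] by simp
    moreover have "e \<le> dist L (g z)"
      using i(2) j(2) by (intro tendsto_lowerbound[OF tendsto_dist[OF i(2) tendsto_const]]) auto
    ultimately show False using e(1) by simp
  qed
  then show ?thesis using k(1) that by blast
qed

section \<open>Weakly null sequences and lower bounds for the modulus\<close>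

text \<open>
  The norming functional \<open>F m\<close> of \<open>y + u m\<close> controls the plus sign and \<open>F n\<close> the minus sign, once
  \<open>F m (u n)\<close> and \<open>F n (u m)\<close> are small. The latter is weak convergence; the former holds for
  arbitrarily late \<open>n\<close> because some convex combination of the \<open>u n\<close> is small in norm.
\<close>
lemma weakly_null_symmetric_pair:
  fixes y :: "'a::real_normed_vector"
  assumes u: "weakly_tendsto u 0" and ge: "\<And>n. r \<le> norm (y + u n)" and "0 < e"
  obtains m n where "N \<le> m" "N \<le> n"
    "r - e \<le> norm (y + (u m - u n))" "r - e \<le> norm (y - (u m - u n))"
proof -
  have "\<forall>n. \<exists>f :: 'a \<Rightarrow>\<^sub>L real. norm f \<le> 1 \<and> blinfun_apply f (y + u n) = norm (y + u n)"
    using norming_functional by metis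
  then obtain F :: "nat \<Rightarrow> ('a \<Rightarrow>\<^sub>L real)"
    where F: "\<And>n. norm (F n) \<le> 1" "\<And>n. F n (y + u n) = norm (y + u n)"
    by metis
  \<comment> \<open>If this fails, every \<open>u n\<close> with \<open>N \<le> n\<close> lies in
    the convex set \<open>?S\<close>, whose elements have norm at least \<open>e\<close>; separating
    the hull of the tail from \<open>0\<close> then contradicts weak nullness.\<close>
  have "\<exists>n\<ge>N. \<exists>\<^sub>F m in sequentially. F m (u n) \<le> e"
  proof (rule ccontr)
    assume nex: "\<not> ?thesis"
    have ev: "\<forall>\<^sub>F m in sequentially. e < F m (u n)" if "N \<le> n" for n
    proof -
      from nex that have "\<not> (\<exists>\<^sub>F m in sequentially. F m (u n) \<le> e)" by blast
      then show ?thesis by (simp add: frequently_def not_le)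
    qed
    let ?S = "{v. \<forall>\<^sub>F m in sequentially. e < F m v}"
    have "convex ?S"
    proof (rule convexI)
      fix v w and a b :: real
      assume vw: "v \<in> ?S" "w \<in> ?S" and ab: "0 \<le> a" "0 \<le> b" "a + b = 1"
      then have "\<forall>\<^sub>F m in sequentially. e < F m v \<and> e < F m w"
        by (simp add: eventually_conj)
      then have "\<forall>\<^sub>F m in sequentially. e < F m (a *\<^sub>R v + b *\<^sub>R w)"
      proof eventually_elim
        case (elim m)
        then have "a *\<^sub>R F m v + b *\<^sub>R F m w \<in> {e<..}"
          using ab by (intro convexD[OF convex_real_interval(3)]) auto
        then show ?case by (simp add: blinfun.add_right blinfun.scaleR_right)
      qed
      then show "a *\<^sub>R v + b *\<^sub>R w \<in> ?S" by simp
    qed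
    moreover have "u ` {N..} \<subseteq> ?S" using ev by auto
    ultimately have "convex hull (u ` {N..}) \<subseteq> ?S" by (rule hull_minimal[rotated])
    moreover have "e \<le> norm v" if "v \<in> ?S" for v
    proof -
      have "\<exists>m. e < F m v" using that eventually_happens by fastforce
      then obtain m where "e < F m v" ..
      then show ?thesis using blinfun_le_norm[OF F(1)[of m], of v] by simp
    qed
    ultimately have "e \<le> norm (v - 0)" if "v \<in> convex hull (u ` {N..})" for v
      using that by auto
    then obtain f :: "'a \<Rightarrow>\<^sub>L real" where f: "\<And>v. v \<in> convex hull (u ` {N..}) \<Longrightarrow> f v \<le> f 0 - e"
      using convex_separation[of "convex hull (u ` {N..})" e 0] \<open>0 < e\<close>
      by (metis atLeast_iff convex_convex_hull convex_hull_eq_empty empty_iff image_is_empty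
          less_le order_refl)
    have "f (u n) \<le> - e" if "N \<le> n" for n
      using f[OF hull_inc, of "u n"] that by (simp add: blinfun.zero_right)
    then have "f 0 \<le> - e"
      by (intro tendsto_upperbound[OF weakly_tendstoD[OF u]] eventually_sequentiallyI[of N]) auto
    then show False using \<open>0 < e\<close> by (simp add: blinfun.zero_right)
  qed
  then obtain n where n: "N \<le> n" "\<exists>\<^sub>F m in sequentially. F m (u n) \<le> e" by blast
  have "\<forall>\<^sub>F m in sequentially. F n (u m) < e"
    using weakly_tendstoD[OF u, of "F n"] \<open>0 < e\<close>
    by (intro order_tendstoD(2)) (auto simp: blinfun.zero_right)
  moreover have "\<forall>\<^sub>F m in sequentially. N \<le> m" by (rule eventually_ge_at_top)
  ultimately have "\<forall>\<^sub>F m in sequentially. F n (u m) < e \<and> N \<le> m" by (rule eventually_conj)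
  \<comment> \<open>Since \<open>n\<close> is fixed first, the condition frequent in
    \<open>m\<close> can be combined with weak convergence under \<open>F n\<close>.\<close>
  from frequently_eventually_frequently[OF n(2) this]
  obtain m where m: "F m (u n) \<le> e" "F n (u m) < e" "N \<le> m"
    by (auto dest!: frequently_ex)
  have "r - e \<le> F m ((y + u m) - u n)"
    using ge[of m] m(1) F(2)[of m] by (simp only: blinfun.diff_right)
  also have "\<dots> \<le> norm ((y + u m) - u n)" by (rule blinfun_le_norm[OF F(1)])
  finally have 1: "r - e \<le> norm (y + (u m - u n))" by (simp add: algebra_simps)
  have "r - e \<le> F n ((y + u n) - u m)"
    using ge[of n] m(2) F(2)[of n] by (simp only: blinfun.diff_right)
  also have "\<dots> \<le> norm ((y + u n) - u m)" by (rule blinfun_le_norm[OF F(1)])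
  finally have 2: "r - e \<le> norm (y - (u m - u n))" by (simp add: algebra_simps)
  show ?thesis by (rule that[OF m(3) n(1) 1 2])
qed

text \<open>Rescaling \<open>y\<close> by \<open>1 / a\<close> and \<open>w n\<close> by
  \<open>1 / b\<close> puts them in the unit ball, and the parameter \<open>b / a\<close> restores
  \<open>y + w n\<close> and \<open>y - w n\<close> up to the factor \<open>1 / a\<close>.\<close>

lemma nus_modulus_ge:
  fixes y :: "'a::real_normed_vector"
  assumes w: "weakly_tendsto w 0" and "0 < a" "0 < b"
    and y: "norm y \<le> a" and wb: "\<And>n. norm (w n) \<le> b"
    and ge: "\<And>n. c \<le> norm (y + w n)" "\<And>n. c \<le> norm (y - w n)"
  shows "c / a - 1 \<le> nus_modulus TYPE('a) (b / a)"
proof -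
  \<comment> \<open>Index \<open>0\<close> is taken by the distinguished first term, so
    \<open>w 0\<close> is dropped; one altered term does not affect the weak limit.\<close>
  define x where "x n = (if n = 0 then (1 / a) *\<^sub>R y else (1 / b) *\<^sub>R w n)" for n :: nat
  have "weakly_tendsto (\<lambda>n. (1 / b) *\<^sub>R w n) 0"
    using weakly_tendsto_scaleR[OF w, of "1 / b"] by simp
  then have "weakly_tendsto x 0"
    by (rule weakly_tendsto_cong_sequentially)
      (auto simp: x_def eventually_sequentially intro!: exI[of _ 1])
  moreover have "\<forall>n. x n \<in> cball 0 1"
    using assms by (auto simp: x_def field_simps)
  moreover have "c / a - 1 \<le> (INF n\<in>{1..}. (norm (x 0 + (b / a) *\<^sub>R x n) + norm (x 0 - (b / a) *\<^sub>R x n)) / 2 - 1)"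
  proof (rule cINF_greatest)
    fix n :: nat assume "n \<in> {1..}"
    then have "x 0 + (b / a) *\<^sub>R x n = (1 / a) *\<^sub>R (y + w n)"
      "x 0 - (b / a) *\<^sub>R x n = (1 / a) *\<^sub>R (y - w n)"
      using assms(2,3) by (auto simp: x_def algebra_simps)
    then have "norm (x 0 + (b / a) *\<^sub>R x n) = norm (y + w n) / a"
      "norm (x 0 - (b / a) *\<^sub>R x n) = norm (y - w n) / a"
      using assms(2) by simp_all
    then show "c / a - 1 \<le> (norm (x 0 + (b / a) *\<^sub>R x n) + norm (x 0 - (b / a) *\<^sub>R x n)) / 2 - 1"
      using ge[of n] assms(2) by (simp add: field_simps)
  qed simp
  ultimately show ?thesis
    using nus_INF_le_modulus[of x "b / a"] assms(2,3) by fastforce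
qed

section \<open>Minimal invariant sets of nonexpansive maps\<close>

text \<open>The hypothetical counterexample. Minimality acts as an induction principle: a property
  holds on all of \<open>K\<close> once the points of \<open>K\<close> having it form a nonempty
  closed convex invariant set.\<close>

locale minimal_nonexpansive =
  fixes T :: "'a::banach \<Rightarrow> 'a" and K :: "'a set"
  assumes refl: "reflexive_space TYPE('a)"
    and nonempty: "K \<noteq> {}" and closed: "closed K" and bounded: "bounded K" and convex: "convex K"
    and invariant: "\<And>x. x \<in> K \<Longrightarrow> T x \<in> K"
    and nonexpansive: "\<And>x y. x \<in> K \<Longrightarrow> y \<in> K \<Longrightarrow> norm (T x - T y) \<le> norm (x - y)"
    and minimal: "\<And>L. L \<subseteq> K \<Longrightarrow> L \<noteq> {} \<Longrightarrow> closed L \<Longrightarrow> convex L \<Longrightarrow>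
      (\<And>x. x \<in> L \<Longrightarrow> T x \<in> L) \<Longrightarrow> L = K"
    and no_fixed_point: "\<And>x. x \<in> K \<Longrightarrow> T x \<noteq> x"
begin

lemma norm_diff_le_diameter: "x \<in> K \<Longrightarrow> y \<in> K \<Longrightarrow> norm (x - y) \<le> diameter K"
  using diameter_bounded_bound[OF bounded] by (simp add: dist_norm)

lemma diameter_pos: "0 < diameter K"
proof -
  obtain x where x: "x \<in> K" using nonempty by blast
  then have "0 < norm (T x - x)" using no_fixed_point by simp
  also have "\<dots> \<le> diameter K" using x invariant by (intro norm_diff_le_diameter)
  finally show ?thesis .
qed

text \<open>The centres in \<open>K\<close> of closed \<open>r\<close>-balls covering
  \<open>K\<close> form a closed convex invariant set; if it were nonempty, it would be
  \<open>K\<close>, and the diameter would be at most \<open>r\<close>.\<close>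

lemma diametral:
  assumes "x \<in> K" "r < diameter K"
  shows "\<exists>v\<in>K. r < norm (x - v)"
proof (rule ccontr)
  assume "\<not> ?thesis"
  then have xr: "norm (x - v) \<le> r" if "v \<in> K" for v using that by force
  let ?A = "K \<inter> (\<Inter>v\<in>K. cball v r)"
  have "?A = K"
  proof (rule minimal)
    show "?A \<noteq> {}" using xr assms(1) by (auto simp: dist_norm norm_minus_commute)
    show "closed ?A" using closed by (intro closed_Int closed_INT) auto
    show "convex ?A" using convex by (intro convex_Int convex_INT) auto
    fix a assume a: "a \<in> ?A"
    \<comment> \<open>Since \<open>a\<close> is within \<open>r\<close> of all of \<open>K\<close>,
      nonexpansiveness maps \<open>K\<close> into the ball around \<open>T a\<close>, so the
      intersection is invariant and minimality applies.\<close>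
    have "K \<inter> cball (T a) r = K"
    proof (rule minimal)
      have "T v \<in> cball (T a) r" if "v \<in> K" for v
        using nonexpansive[of a v] a that by (auto simp: dist_norm norm_minus_commute intro: order_trans)
      then show "K \<inter> cball (T a) r \<noteq> {}" "\<And>v. v \<in> K \<inter> cball (T a) r \<Longrightarrow> T v \<in> K \<inter> cball (T a) r"
        using invariant nonempty by blast+
    qed (use closed convex in \<open>auto intro: convex_Int\<close>)
    then have "dist (T a) v \<le> r" if "v \<in> K" for v using that by (metis IntD2 mem_cball)
    then show "T a \<in> ?A" using a invariant by (auto simp: dist_commute)
  qed simp
  then have "dist a b \<le> r" if "a \<in> K" "b \<in> K" for a b
    using that by (metis IntD2 INT_iff mem_cball dist_commute)
  then have "diameter K \<le> r"
    using nonempty by (intro diameter_le) (auto simp: dist_norm)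
  then show False using assms(2) by simp
qed

lemma weakly_convergent_subseq_in:
  fixes x :: "nat \<Rightarrow> 'a"
  assumes "\<And>n. x n \<in> K"
  obtains s l where "strict_mono s" "l \<in> K" "weakly_tendsto (\<lambda>n. x (s n)) l"
proof -
  have "bounded (range x)" using assms bounded by (auto intro: bounded_subset)
  then obtain s l where s: "strict_mono s" "weakly_tendsto (\<lambda>n. x (s n)) l"
    using reflexive_weakly_convergent_subseq[OF refl, of x] by metis
  then have "l \<in> K"
    using closed convex assms by (intro weakly_tendsto_mem_closed_convex) auto
  then show ?thesis using that s by blast
qed

text \<open>The Goebel-Karlovitz lemma, in the form due to Lin.\<close>
lemma approximate_fixed_points_far:
  assumes "x \<in> K" "r < diameter K"
  obtains e where "0 < e" "\<And>v. v \<in> K \<Longrightarrow> norm (v - T v) < e \<Longrightarrow> r < norm (v - x)"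
proof (rule ccontr)
  assume not: "\<not> thesis"
  have "\<exists>v\<in>K. norm (v - T v) < 1 / real (Suc n) \<and> norm (v - x) \<le> r" for n
  proof (rule ccontr)
    assume "\<not> ?thesis"
    then have "thesis" by (intro that[of "1 / real (Suc n)"]) force+
    then show False using not by blast
  qed
  then obtain w where w: "\<And>n. w n \<in> K" "\<And>n. norm (w n - T (w n)) < 1 / real (Suc n)"
    "\<And>n. norm (w n - x) \<le> r"
    by metis
  obtain s l where s: "strict_mono s" "l \<in> K" "weakly_tendsto (\<lambda>n. w (s n)) l"
    by (rule weakly_convergent_subseq_in[OF w(1)])
  have "(\<lambda>n. w n - T (w n)) \<longlonglongrightarrow> 0"
    using w(2) by (intro LIMSEQ_norm_0) (auto intro: less_imp_le)
  from LIMSEQ_subseq_LIMSEQ[OF this s(1)]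
  have afp: "(\<lambda>n. w (s n) - T (w (s n))) \<longlonglongrightarrow> 0" by (simp add: comp_def)
  \<comment> \<open>The points whose asymptotic distance from the sequence is at most
    \<open>r\<close>: \<open>x\<close> is one, and \<open>T\<close> preserves them because the
    sequence is almost fixed.\<close>
  let ?A = "{v \<in> K. \<forall>e>0. \<forall>\<^sub>F n in sequentially. norm (w (s n) - v) \<le> r + e}"
  have "?A = K"
  proof (rule minimal)
    show "?A \<noteq> {}" using assms(1) w(3) by (auto intro!: exI[of _ x] always_eventually add_increasing2)
    show "closed ?A"
      unfolding closed_sequential_limits
    proof (intro allI impI, elim conjE)
      fix v l assume v: "\<forall>n. v n \<in> ?A" "v \<longlonglongrightarrow> l"
      then have "l \<in> K" using closed_sequentially[OF closed, of v l] by blast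
      moreover have "\<forall>\<^sub>F n in sequentially. norm (w (s n) - l) \<le> r + e" if "0 < e" for e
      proof -
        obtain k where k: "norm (v k - l) < e / 2"
          using LIMSEQ_D[OF v(2), of "e / 2"] \<open>0 < e\<close> by auto
        have "\<forall>\<^sub>F n in sequentially. norm (w (s n) - v k) \<le> r + e / 2"
          using v(1) \<open>0 < e\<close> by auto
        then show ?thesis
        proof eventually_elim
          case (elim n)
          then show ?case using k norm_diff_triangle_ineq[of "w (s n)" "v k" "v k" l] by (simp add: algebra_simps)
        qed
      qed
      ultimately show "l \<in> ?A" by blast
    qed
    show "convex ?A"
    proof (rule convexI)
      fix v v' and a b :: real
      assume v: "v \<in> ?A" "v' \<in> ?A" and ab: "0 \<le> a" "0 \<le> b" "a + b = 1"
      have "\<forall>\<^sub>F n in sequentially. norm (w (s n) - (a *\<^sub>R v + b *\<^sub>R v')) \<le> r + e" if "0 < e" for e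
      proof -
        have "\<forall>\<^sub>F n in sequentially. norm (w (s n) - v) \<le> r + e"
          "\<forall>\<^sub>F n in sequentially. norm (w (s n) - v') \<le> r + e"
          using v that by auto
        then show ?thesis
        proof eventually_elim
          case (elim n)
          then have "a *\<^sub>R v + b *\<^sub>R v' \<in> cball (w (s n)) (r + e)"
            using ab by (intro convexD[OF convex_cball]) (auto simp: dist_norm)
          then show ?case by (simp add: dist_norm)
        qed
      qed
      then show "a *\<^sub>R v + b *\<^sub>R v' \<in> ?A" using v ab convexD[OF convex] by blast
    qed
    fix v assume v: "v \<in> ?A"
    have "\<forall>\<^sub>F n in sequentially. norm (w (s n) - T v) \<le> r + e" if "0 < e" for e
    proof -
      have "\<forall>\<^sub>F n in sequentially. norm (w (s n) - v) \<le> r + e / 2"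
        using v that by auto
      moreover have "\<forall>\<^sub>F n in sequentially. norm (w (s n) - T (w (s n))) < e / 2"
        using order_tendstoD(2)[OF tendsto_norm[OF afp], of "e / 2"] that by simp
      ultimately show ?thesis
      proof eventually_elim
        case (elim n)
        have "norm (T (w (s n)) - T v) \<le> norm (w (s n) - v)"
          using v w(1) by (intro nonexpansive) auto
        then show ?case
          using elim norm_triangle_ineq[of "w (s n) - T (w (s n))" "T (w (s n)) - T v"] by simp
      qed
    qed
    then show "T v \<in> ?A" using v invariant by blast
  qed blast
  \<comment> \<open>Weak lower semicontinuity of the norm turns the asymptotic bound into a bound
    from \<open>l\<close> to every point of \<open>K\<close>, against
    \<open>diametral\<close>.\<close>
  have "norm (l - v) \<le> r" if "v \<in> K" for v
  proof (rule field_le_epsilon)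
    fix e :: real assume "0 < e"
    then have "\<forall>\<^sub>F n in sequentially. norm (w (s n) - v) \<le> r + e"
      using that \<open>?A = K\<close> by blast
    then show "norm (l - v) \<le> r + e"
      by (rule weakly_tendsto_norm_le[OF weakly_tendsto_diff[OF s(3) weakly_tendsto_const]])
  qed
  then show False using diametral[OF s(2) assms(2)] by force
qed

section \<open>Relaxed fixed points and the separated sequence\<close>

lemma relaxed_fixed_point:
  assumes "q \<in> K" "0 < c" "c < 1"
  obtains z where "z \<in> K" "z = (1 - c) *\<^sub>R T z + c *\<^sub>R q"
proof -
  have "\<exists>!z\<in>K. (1 - c) *\<^sub>R T z + c *\<^sub>R q = z"
  proof (rule Banach_fix)
    show "complete K" using closed by (simp add: complete_eq_closed)
    show "(\<lambda>z. (1 - c) *\<^sub>R T z + c *\<^sub>R q) ` K \<subseteq> K"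
      using assms convexD[OF convex] invariant by auto
    fix x y assume "x \<in> K" "y \<in> K"
    moreover have "((1 - c) *\<^sub>R T x + c *\<^sub>R q) - ((1 - c) *\<^sub>R T y + c *\<^sub>R q) = (1 - c) *\<^sub>R (T x - T y)"
      by (simp add: algebra_simps)
    ultimately show "dist ((1 - c) *\<^sub>R T x + c *\<^sub>R q) ((1 - c) *\<^sub>R T y + c *\<^sub>R q) \<le> (1 - c) * dist x y"
      using assms nonexpansive[of x y] by (simp add: dist_norm mult_left_mono)
  qed (use assms nonempty in auto)
  then show ?thesis using that by metis
qed

lemma relaxed_fixed_point_displacement:
  assumes "q \<in> K" "0 < c" "z \<in> K" "z = (1 - c) *\<^sub>R T z + c *\<^sub>R q"
  shows "norm (z - T z) \<le> c * diameter K"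
proof -
  have "z - T z = c *\<^sub>R (q - T z)"
    by (subst assms(4)) (simp add: algebra_simps)
  then show ?thesis
    using assms norm_diff_le_diameter[OF assms(1) invariant[OF assms(3)]] by (simp add: mult_left_mono)
qed

lemma approximate_fixed_points:
  obtains x p where "\<And>n. x n \<in> K" "p \<in> K" "(\<lambda>n. x n - T (x n)) \<longlonglongrightarrow> 0" "weakly_tendsto x p"
proof -
  obtain q where q: "q \<in> K" using nonempty by blast
  \<comment> \<open>The shift by \<open>2\<close> keeps \<open>c n\<close> strictly below
    \<open>1\<close> already at \<open>n = 0\<close>.\<close>
  define c where "c n = 1 / real (n + 2)" for n
  have c: "0 < c n" "c n < 1" for n by (auto simp: c_def)
  have "\<exists>z\<in>K. z = (1 - c n) *\<^sub>R T z + c n *\<^sub>R q" for n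
    using relaxed_fixed_point[OF q c] by metis
  then obtain w where w: "\<And>n. w n \<in> K" "\<And>n. w n = (1 - c n) *\<^sub>R T (w n) + c n *\<^sub>R q" by metis
  have "c \<longlonglongrightarrow> 0" unfolding c_def using LIMSEQ_ignore_initial_segment[OF lim_1_over_n] .
  have "(\<lambda>n. w n - T (w n)) \<longlonglongrightarrow> 0"
  proof (rule Lim_null_comparison)
    show "\<forall>\<^sub>F n in sequentially. norm (w n - T (w n)) \<le> c n * diameter K"
      using relaxed_fixed_point_displacement[OF q c(1) w] by simp
    show "(\<lambda>n. c n * diameter K) \<longlonglongrightarrow> 0"
      using \<open>c \<longlonglongrightarrow> 0\<close> by (rule tendsto_mult_left_zero)
  qed
  moreover obtain s l where s: "strict_mono s" "l \<in> K" "weakly_tendsto (\<lambda>n. w (s n)) l"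
    by (rule weakly_convergent_subseq_in[OF w(1)])
  ultimately have "(\<lambda>n. w (s n) - T (w (s n))) \<longlonglongrightarrow> 0"
    using LIMSEQ_subseq_LIMSEQ by (fastforce simp: comp_def)
  then show ?thesis using that[of "\<lambda>n. w (s n)" l] w(1) s by blast
qed

text \<open>Relaxing towards \<open>t *\<^sub>R x n + (1 - t) *\<^sub>R p\<close> passes two bounds
  from these anchors to the \<open>z n\<close>: mutual distances at most \<open>t\<close> times the
  diameter, and, up to a vanishing error, distance to \<open>x n\<close> at most
  \<open>1 - t\<close> times it.\<close>

lemma far_separated_sequence:
  assumes t: "0 < t" "t < 1" and "0 < e"
  obtains z :: "nat \<Rightarrow> 'a" and p q where "weakly_tendsto z q"
    "\<And>m n. norm (z m - z n) \<le> t * diameter K" "norm (q - p) \<le> (1 - t) * diameter K"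
    "\<And>n. diameter K - e \<le> norm (z n - p)"
proof -
  obtain x p where x: "\<And>n. x n \<in> K" "p \<in> K" "(\<lambda>n. x n - T (x n)) \<longlonglongrightarrow> 0" "weakly_tendsto x p"
    using approximate_fixed_points by metis
  obtain \<delta> where \<delta>: "0 < \<delta>" "\<And>v. v \<in> K \<Longrightarrow> norm (v - T v) < \<delta> \<Longrightarrow> diameter K - e < norm (v - p)"
    using approximate_fixed_points_far[OF x(2), of "diameter K - e"] \<open>0 < e\<close> by auto
  \<comment> \<open>The entry \<open>1 / 2\<close> keeps \<open>c\<close> below \<open>1\<close>;
    the other one puts the displacement bound \<open>c * diameter K\<close> strictly under
    \<open>\<delta>\<close>.\<close>
  define c where "c = min (1 / 2) (\<delta> / (2 * diameter K))"
  have c: "0 < c" "c < 1" using \<delta>(1) diameter_pos by (auto simp: c_def)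
  have "c * diameter K \<le> \<delta> / (2 * diameter K) * diameter K"
    using diameter_pos by (intro mult_right_mono) (auto simp: c_def)
  also have "\<dots> < \<delta>" using \<delta>(1) diameter_pos by simp
  finally have c_small: "c * diameter K < \<delta>" .
  have xp: "t *\<^sub>R x n + (1 - t) *\<^sub>R p \<in> K" for n
    using t x convexD[OF convex] by auto
  have "\<exists>z\<in>K. z = (1 - c) *\<^sub>R T z + c *\<^sub>R (t *\<^sub>R x n + (1 - t) *\<^sub>R p)" for n
    using relaxed_fixed_point[OF xp c] by metis
  then obtain z where z: "\<And>n. z n \<in> K"
    "\<And>n. z n = (1 - c) *\<^sub>R T (z n) + c *\<^sub>R (t *\<^sub>R x n + (1 - t) *\<^sub>R p)"
    by metis
  have far: "diameter K - e \<le> norm (z n - p)" for n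
    using \<delta>(2)[OF z(1)] relaxed_fixed_point_displacement[OF xp c(1) z] c_small
    by (meson le_less_trans less_imp_le)
  have dz: "norm (z m - z n) \<le> t * diameter K" for m n
  proof -
    \<comment> \<open>The \<open>T\<close> part contributes at most \<open>1 - c\<close> times
      \<open>norm (z m - z n)\<close>; absorbing it leaves the factor \<open>c\<close> on both
      sides.\<close>
    have "z m - z n = (1 - c) *\<^sub>R (T (z m) - T (z n)) + (c * t) *\<^sub>R (x m - x n)"
      by (subst (1 2) z(2)) (simp add: algebra_simps)
    then have "norm (z m - z n) \<le> (1 - c) * norm (T (z m) - T (z n)) + c * t * norm (x m - x n)"
      using norm_triangle_ineq[of "(1 - c) *\<^sub>R (T (z m) - T (z n))" "(c * t) *\<^sub>R (x m - x n)"] c t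
      by simp
    also have "\<dots> \<le> (1 - c) * norm (z m - z n) + c * t * diameter K"
      using c t nonexpansive[OF z(1) z(1)] norm_diff_le_diameter[OF x(1) x(1)]
      by (intro add_mono mult_left_mono) auto
    finally have "c * norm (z m - z n) \<le> c * (t * diameter K)" by (simp add: algebra_simps)
    then show ?thesis using c(1) by simp
  qed
  have zx: "norm (z n - x n) \<le> norm (x n - T (x n)) / c + (1 - t) * diameter K" for n
  proof -
    have "z n - x n = (1 - c) *\<^sub>R (T (z n) - T (x n)) - ((1 - c) *\<^sub>R (x n - T (x n)) + (c * (1 - t)) *\<^sub>R (x n - p))"
      by (subst z(2)) (simp add: algebra_simps)
    then have "norm (z n - x n) \<le> norm ((1 - c) *\<^sub>R (T (z n) - T (x n)))
        + norm ((1 - c) *\<^sub>R (x n - T (x n)) + (c * (1 - t)) *\<^sub>R (x n - p))"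
      using norm_triangle_ineq4 by metis
    also have "\<dots> \<le> norm ((1 - c) *\<^sub>R (T (z n) - T (x n)))
        + (norm ((1 - c) *\<^sub>R (x n - T (x n))) + norm ((c * (1 - t)) *\<^sub>R (x n - p)))"
      by (intro add_left_mono norm_triangle_ineq)
    also have "\<dots> = (1 - c) * norm (T (z n) - T (x n))
        + ((1 - c) * norm (x n - T (x n)) + c * (1 - t) * norm (x n - p))"
      using c t by simp
    also have "\<dots> \<le> (1 - c) * norm (z n - x n) + (1 * norm (x n - T (x n)) + c * (1 - t) * diameter K)"
      using c t nonexpansive[OF z(1) x(1)] norm_diff_le_diameter[OF x(1) x(2)]
      by (intro add_mono mult_left_mono mult_right_mono) auto
    finally have "c * norm (z n - x n) \<le> norm (x n - T (x n)) + c * ((1 - t) * diameter K)"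
      by (simp add: algebra_simps)
    then show ?thesis using c(1) by (simp add: field_simps)
  qed
  obtain s q where s: "strict_mono s" "q \<in> K" "weakly_tendsto (\<lambda>n. z (s n)) q"
    by (rule weakly_convergent_subseq_in[OF z(1)])
  have sub: "filterlim s sequentially sequentially" using s(1) by (rule filterlim_subseq)
  have "norm (q - p) \<le> (1 - t) * diameter K"
  proof (rule field_le_epsilon)
    fix b :: real assume "0 < b"
    have "(\<lambda>n. norm (x n - T (x n)) / c) \<longlonglongrightarrow> 0"
      using tendsto_divide[OF tendsto_norm[OF x(3)] tendsto_const, of c] c by simp
    then have "\<forall>\<^sub>F n in sequentially. norm (x n - T (x n)) / c < b"
      using \<open>0 < b\<close> by (rule order_tendstoD(2))
    then have "\<forall>\<^sub>F n in sequentially. norm (z n - x n) \<le> (1 - t) * diameter K + b"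
    proof eventually_elim
      case (elim n)
      then show ?case using zx[of n] by simp
    qed
    then have "\<forall>\<^sub>F n in sequentially. norm (z (s n) - x (s n)) \<le> (1 - t) * diameter K + b"
      by (rule eventually_compose_filterlim[OF _ sub])
    then show "norm (q - p) \<le> (1 - t) * diameter K + b"
      by (rule weakly_tendsto_norm_le[OF weakly_tendsto_diff[OF s(3) weakly_tendsto_compose[OF x(4) sub]]])
  qed
  then show ?thesis using that[of "\<lambda>n. z (s n)" q p] s(3) dz far by blast
qed

lemma nus_modulus_ge_identity:
  assumes t: "0 < t" "t < 1"
  shows "t / (1 - t) \<le> nus_modulus TYPE('a) (t / (1 - t))"
proof (rule field_le_epsilon)
  fix h :: real assume "0 < h"
  define d where "d = diameter K"
  have "0 < d" unfolding d_def by (rule diameter_pos)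
  \<comment> \<open>The distance to \<open>p\<close> and the choice of the pair each lose
    \<open>e\<close>; division by \<open>(1 - t) * d\<close> turns \<open>2 * e\<close> into
    \<open>h\<close>.\<close>
  define e where "e = h * ((1 - t) * d) / 2"
  have "0 < e" using \<open>0 < h\<close> \<open>0 < d\<close> t by (simp add: e_def)
  obtain z :: "nat \<Rightarrow> 'a" and p q where z: "weakly_tendsto z q"
    "\<And>m n. norm (z m - z n) \<le> t * d" "norm (q - p) \<le> (1 - t) * d"
    "\<And>n. d - e \<le> norm (z n - p)"
    by (rule far_separated_sequence[OF t \<open>0 < e\<close>, folded d_def]) blast
  define u where "u n = z n - q" for n
  have u: "weakly_tendsto u 0"
    using weakly_tendsto_diff[OF z(1) weakly_tendsto_const, of q] by (simp add: u_def[abs_def])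
  have "d - e \<le> norm ((q - p) + u n)" for n using z(4)[of n] by (simp add: u_def)
  note pair = weakly_null_symmetric_pair[OF u this \<open>0 < e\<close>]
  \<comment> \<open>A pair is taken beyond every \<open>N\<close>, so that both index sequences tend
    to infinity and the differences are weakly null.\<close>
  have "\<exists>m n. N \<le> m \<and> N \<le> n \<and> (d - e) - e \<le> norm ((q - p) + (u m - u n)) \<and>
      (d - e) - e \<le> norm ((q - p) - (u m - u n))" for N
    by (rule pair[of N]) blast
  then obtain i j where ij: "\<And>N. N \<le> i N" "\<And>N. N \<le> j N"
    "\<And>N. (d - e) - e \<le> norm ((q - p) + (u (i N) - u (j N)))"
    "\<And>N. (d - e) - e \<le> norm ((q - p) - (u (i N) - u (j N)))"
    by metis
  have ij_lim: "filterlim i sequentially sequentially" "filterlim j sequentially sequentially"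
    using ij(1,2) by (auto intro!: filterlim_at_top_mono[OF filterlim_ident] always_eventually)
  have w: "weakly_tendsto (\<lambda>N. u (i N) - u (j N)) 0"
    using weakly_tendsto_diff[OF weakly_tendsto_compose[OF u ij_lim(1)]
        weakly_tendsto_compose[OF u ij_lim(2)]] by simp
  have "((d - e) - e) / ((1 - t) * d) - 1 \<le> nus_modulus TYPE('a) ((t * d) / ((1 - t) * d))"
  proof (rule nus_modulus_ge[OF w _ _ z(3) _ ij(3,4)])
    show "norm (u (i N) - u (j N)) \<le> t * d" for N using z(2) by (simp add: u_def)
  qed (use \<open>0 < d\<close> t in simp_all)
  moreover have "((d - e) - e) / ((1 - t) * d) - 1 = t / (1 - t) - h"
    using \<open>0 < d\<close> t by (simp add: e_def field_simps)
  ultimately show "t / (1 - t) \<le> nus_modulus TYPE('a) (t / (1 - t)) + h"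
    using \<open>0 < d\<close> by simp
qed

text \<open>Putting \<open>t / (1 + t)\<close> for \<open>t\<close> in the previous bound turns
  \<open>t / (1 - t)\<close> into \<open>t\<close>, so the quotient is at least \<open>1\<close> at
  every positive \<open>t\<close>.\<close>

lemma nus_modulus_deriv0_ge_1: "1 \<le> nus_modulus_deriv0 TYPE('a)"
proof -
  \<comment> \<open>A point that \<open>T\<close> moves shows that the space is nonzero, as the
    existence of the limit requires.\<close>
  obtain v where v: "(v :: 'a) \<noteq> 0"
    using nonempty no_fixed_point by (metis ex_in_conv)
  have "1 \<le> nus_modulus TYPE('a) t / t" if "0 < t" for t
  proof -
    have "(t / (1 + t)) / (1 - t / (1 + t)) = t" using that by (simp add: field_simps)
    then show ?thesis using nus_modulus_ge_identity[of "t / (1 + t)"] that by simp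
  qed
  then have "\<forall>\<^sub>F t in at_right 0. 1 \<le> nus_modulus TYPE('a) t / t"
    using eventually_at_right_less[of "0::real"] by (auto elim: eventually_mono)
  then show ?thesis
    by (intro tendsto_lowerbound[OF nus_modulus_quotient_tendsto[OF v]]) auto
qed

end

section \<open>Existence of minimal invariant sets and the conclusion\<close>

text \<open>Zorn's lemma for reverse inclusion: the bound of a nonempty chain is its intersection,
  nonempty by reflexivity, and that of the empty chain is \<open>C\<close>.\<close>

lemma minimal_nonexpansive_exists:
  fixes T :: "'a::banach \<Rightarrow> 'a"
  assumes refl: "reflexive_space TYPE('a)"
    and C: "C \<noteq> {}" "closed C" "bounded C" "convex C" "T ` C \<subseteq> C" "1-lipschitz_on C T"
    and no_fix: "\<And>x. x \<in> C \<Longrightarrow> T x \<noteq> x"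
  obtains K where "minimal_nonexpansive T K"
proof -
  define A where "A = {K. K \<subseteq> C \<and> K \<noteq> {} \<and> closed K \<and> convex K \<and> T ` K \<subseteq> K}"
  have A_bounded: "bounded K" if "K \<in> A" for K
    using that C(3) by (auto simp: A_def intro: bounded_subset)
  have "\<exists>K\<in>A. \<forall>L\<in>A. L \<subseteq> K \<longrightarrow> L = K"
  proof (rule predicate_Zorn)
    show "partial_order_on A (relation_of (\<lambda>K L. L \<subseteq> K) A)"
      by (rule partial_order_on_relation_ofI) auto
  next
    fix \<C> assume "\<C> \<in> Chains (relation_of (\<lambda>K L. L \<subseteq> K) A)"
    then have sub: "\<C> \<subseteq> A" and ch: "\<And>K L. K \<in> \<C> \<Longrightarrow> L \<in> \<C> \<Longrightarrow> K \<subseteq> L \<or> L \<subseteq> K"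
      by (auto simp: Chains_def relation_of_def)
    show "\<exists>K\<in>A. \<forall>L\<in>\<C>. K \<subseteq> L"
    proof (cases "\<C> = {}")
      case True
      then show ?thesis using C by (auto simp: A_def)
    next
      case False
      have "\<Inter>\<C> \<noteq> {}"
      proof (rule reflexive_Inter_nonempty[OF refl False])
        fix K assume "K \<in> \<C>"
        then have "K \<in> A" using sub by blast
        then show "K \<noteq> {} \<and> bounded K \<and> closed K \<and> convex K"
          using A_bounded[of K] by (simp add: A_def)
      next
        fix K L assume "K \<in> \<C>" "L \<in> \<C>"
        then show "\<exists>E\<in>\<C>. E \<subseteq> K \<inter> L" using ch by (metis inf.absorb1 inf.absorb2 order_refl)
      qed
      moreover have "T ` \<Inter>\<C> \<subseteq> \<Inter>\<C>"
      proof (rule Inter_greatest)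
        fix K assume "K \<in> \<C>"
        then have "\<Inter>\<C> \<subseteq> K" "T ` K \<subseteq> K" using sub by (auto simp: A_def)
        then show "T ` \<Inter>\<C> \<subseteq> K" by blast
      qed
      moreover have "\<Inter>\<C> \<subseteq> C" using sub False by (auto simp: A_def)
      moreover have "closed (\<Inter>\<C>)" "convex (\<Inter>\<C>)"
        using sub by (auto simp: A_def intro!: closed_Inter convex_Inter)
      ultimately have "\<Inter>\<C> \<in> A" by (simp add: A_def)
      then show ?thesis by blast
    qed
  qed
  then obtain K where K: "K \<in> A" and min: "\<And>L. L \<in> A \<Longrightarrow> L \<subseteq> K \<Longrightarrow> L = K" by metis
  have "minimal_nonexpansive T K"
  proof
    fix x y assume "x \<in> K" "y \<in> K"
    then show "norm (T x - T y) \<le> norm (x - y)"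
      using lipschitz_onD[OF C(6), of x y] K by (auto simp: A_def dist_norm)
  next
    fix L assume "L \<subseteq> K" "L \<noteq> {}" "closed L" "convex L" "\<And>x. x \<in> L \<Longrightarrow> T x \<in> L"
    then show "L = K" using K by (intro min) (auto simp: A_def)
  qed (use K A_bounded no_fix refl in \<open>auto simp: A_def\<close>)
  then show ?thesis by (rule that)
qed

theorem proposition3p1:
  assumes "reflexive_space TYPE('a::banach)"
    and "nus_modulus_deriv0 TYPE('a) < 1"
  shows "fixed_point_property TYPE('a)"
  unfolding fixed_point_property_def
proof (intro allI impI, elim conjE, rule ccontr)
  fix C :: "'a set" and T
  assume "C \<noteq> {}" "closed C" "bounded C" "convex C" "T ` C \<subseteq> C" "1-lipschitz_on C T"
    and "\<not> (\<exists>x\<in>C. T x = x)"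
  then obtain K where "minimal_nonexpansive T K"
    using minimal_nonexpansive_exists[OF assms(1), of C T] by blast
  then show False
    using minimal_nonexpansive.nus_modulus_deriv0_ge_1 assms(2) by fastforce
qed

end
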